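(* Let $\mathbb{H}_1,\mathbb{H}_2$ be complex Hilbert spaces, and let $A\in\mathbb{B}(\mathbb{H}_1,\mathbb{H}_2)$ and $B\in\mathbb{B}(\mathbb{H}_2,\mathbb{H}_1)$. Then for any $x\in\mathbb{H}_1$ and $y\in\mathbb{H}_2$, $$|\langle Ax,y\rangle|+|\langle By,x\rangle|\le \sqrt{\omega\left(|A|+\mathrm{i}|B^*|\right)\,\omega\left(|A^*|+\mathrm{i}|B|\right)+\tfrac12\left\||A|^2+|B^*|^2\right\|+\omega(BA)}\;\|x\|\,\|y\|.$$
   Context: $\mathbb{B}(\mathbb{H}_1,\mathbb{H}_2)$ is the set of bounded linear operators from the complex Hilbert space $\mathbb{H}_1$ to the complex Hilbert space $\mathbb{H}_2$, and $\mathbb{B}(\mathbb{H})=\mathbb{B}(\mathbb{H},\mathbb{H})$. $\|\cdot\|$ denotes the norm induced by the inner product on vectors and the usual operator norm on operators. For a bounded operator $T$ between Hilbert spaces, $T^*$ is its adjoint and $|T|=(T^*T)^{1/2}$. For $T\in\mathbb{B}(\mathbb{H})$, the numerical radius is $\omega(T)=\sup\{|\langle Tx,x\rangle|:x\in\mathbb{H},\|x\|=1\}$. $\mathrm{i}$ is the imaginary unit. *)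

theory Defs
  imports "HOL-Analysis.Analysis"
begin

class scaleC =
  fixes scaleC :: "complex \<Rightarrow> 'a \<Rightarrow> 'a"  (infixr \<open>*\<^sub>C\<close> 75)

class complex_vector = real_vector + scaleC +
  assumes scaleC_add_right: "c *\<^sub>C (x + y) = c *\<^sub>C x + c *\<^sub>C y"
    and scaleC_add_left: "(c + d) *\<^sub>C x = c *\<^sub>C x + d *\<^sub>C x"
    and scaleC_scaleC: "c *\<^sub>C (d *\<^sub>C x) = (c * d) *\<^sub>C x"
    and scaleC_one: "1 *\<^sub>C x = x"
    and scaleR_scaleC: "r *\<^sub>R x = complex_of_real r *\<^sub>C x"

text \<open>The complex inner product is linear in its first argument. Its real part is the inner
  product of the underlying real space, so positive definiteness and the fact that the norm is
  induced by \<open>cinner\<close> come from the axioms of class \<open>real_inner\<close>; they are restated below.\<close>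

class complex_inner = complex_vector + real_inner +
  fixes cinner :: "'a \<Rightarrow> 'a \<Rightarrow> complex"
  assumes cinner_commute: "cinner x y = cnj (cinner y x)"
    and cinner_add_left: "cinner (x + y) z = cinner x z + cinner y z"
    and cinner_scaleC_left: "cinner (c *\<^sub>C x) y = c * cinner x y"
    and inner_eq_Re_cinner: "inner x y = Re (cinner x y)"

class complex_hilbert_space = complex_inner + complete_space

lemma cinner_self_nonneg: "cinner x x \<in> \<real>\<^sub>\<ge>\<^sub>0"
  for x :: "'a::complex_inner"
proof -
  have "Im (cinner x x) = 0"
    using arg_cong[OF cinner_commute[of x x], of Im] by simp
  moreover have "0 \<le> Re (cinner x x)"
    using inner_ge_zero[of x] by (simp add: inner_eq_Re_cinner)
  ultimately show ?thesis
    by (simp add: complex_nonneg_Reals_iff)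
qed

lemma cinner_self_eq_0_iff: "cinner x x = 0 \<longleftrightarrow> x = 0"
  for x :: "'a::complex_inner"
  using cinner_self_nonneg[of x] inner_eq_zero_iff[of x]
  by (auto simp: complex_nonneg_Reals_iff complex_eq_iff inner_eq_Re_cinner)

lemma norm_eq_sqrt_cinner: "norm x = sqrt (Re (cinner x x))"
  for x :: "'a::complex_inner"
  by (simp add: norm_eq_sqrt_inner inner_eq_Re_cinner)

instantiation complex :: complex_hilbert_space
begin

definition scaleC_complex :: "complex \<Rightarrow> complex \<Rightarrow> complex"
  where "scaleC_complex c x = c * x"

definition cinner_complex :: "complex \<Rightarrow> complex \<Rightarrow> complex"
  where "cinner_complex x y = x * cnj y"

instance
  by standard
    (auto simp: scaleC_complex_def cinner_complex_def inner_complex_def algebra_simps scaleR_conv_of_real)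

end

definition bounded_clinear ::
    "('a::{complex_vector,real_normed_vector} \<Rightarrow> 'b::{complex_vector,real_normed_vector}) \<Rightarrow> bool"
  where "bounded_clinear T \<longleftrightarrow> bounded_linear T \<and> (\<forall>c x. T (c *\<^sub>C x) = c *\<^sub>C T x)"

text \<open>Meaningful for bounded complex-linear operators between Hilbert spaces, where the adjoint
  exists and is unique.\<close>

definition adjoint_op ::
    "('a::complex_hilbert_space \<Rightarrow> 'b::complex_hilbert_space) \<Rightarrow> 'b \<Rightarrow> 'a"
  where "adjoint_op T = (THE S. \<forall>x y. cinner (T x) y = cinner x (S y))"

definition positive_op :: "('a::complex_hilbert_space \<Rightarrow> 'a) \<Rightarrow> bool"
  where "positive_op T \<longleftrightarrow> bounded_clinear T \<and> (\<forall>x. cinner (T x) x \<in> \<real>\<^sub>\<ge>\<^sub>0)"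

text \<open>Meaningful for positive operators, which have exactly one positive square root.\<close>

definition sqrt_op :: "('a::complex_hilbert_space \<Rightarrow> 'a) \<Rightarrow> 'a \<Rightarrow> 'a"
  where "sqrt_op T = (THE S. positive_op S \<and> S \<circ> S = T)"

definition abs_op :: "('a::complex_hilbert_space \<Rightarrow> 'b::complex_hilbert_space) \<Rightarrow> 'a \<Rightarrow> 'a"
  where "abs_op T = sqrt_op (adjoint_op T \<circ> T)"

text \<open>On the zero space the supremum is taken over the empty set, and its value is unspecified.\<close>

definition numerical_radius :: "('a::complex_hilbert_space \<Rightarrow> 'a) \<Rightarrow> real"
  where "numerical_radius T = (SUP x\<in>{x. norm x = 1}. cmod (cinner (T x) x))"

end

(*
  Normalise x and y to unit vectors and expand the square of |<Ax,y>| + |<By,x>|. The two squares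
  are bounded by the mixed Schwarz inequality |<Ax,y>|^2 <= <|A|x,x> <|A^*|y,y>; by Cauchy--Schwarz
  in the plane the sum ac + bd of the resulting products is at most |a + ib| |c + id|, and these
  moduli are values of quadratic forms. The cross term is bounded by Buzano's inequality applied to
  Ax, B^*x and y, followed by AM-GM.

  The square root of T = A^*A is s^(1/2) (1 - Y), where Y solves Y = (C + Y^2)/2 with C = 1 - T/s. It
  is a limit of polynomials in T, so an operator intertwining T with T' intertwines their roots;
  this gives complex linearity and uniqueness of |A|, and A|A| = |A^*|A.
*)

theory Submission imports Defs begin

text \<open>Makes results of sort \<open>{real_inner,banach}\<close> applicable to complex Hilbert
  spaces.\<close>

instance complex_hilbert_space \<subseteq> banach ..

section \<open>Orthogonal projection and the Riesz representation\<close>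

lemma parallelogram_law:
  fixes x y :: "'a::real_inner"
  shows "(norm (x + y))\<^sup>2 + (norm (x - y))\<^sup>2 = 2 * (norm x)\<^sup>2 + 2 * (norm y)\<^sup>2"
  unfolding power2_norm_eq_inner by (simp add: algebra_simps inner_commute)

lemma nonneg_quadratic_discriminant:
  fixes a b c :: real
  assumes "\<And>t. 0 \<le> a + 2 * t * b + t\<^sup>2 * c" and "0 \<le> c"
  shows "b\<^sup>2 \<le> a * c"
proof (cases "c = 0")
  case True
  have "b = 0"
  proof (rule ccontr)
    assume "b \<noteq> 0"
    then show False
      \<comment> \<open>For \<open>c = 0\<close> the form is affine in \<open>t\<close>, and this
        \<open>t\<close> gives it the value -1.\<close>
      using assms(1)[of "- (a + 1) / (2 * b)"] assms(1)[of 0] True by (simp add: field_simps)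
  qed
  then show ?thesis using True by simp
next
  case False
  then have "c > 0" using assms(2) by simp
  then show ?thesis
    \<comment> \<open>The minimiser of the quadratic.\<close>
    using assms(1)[of "- b / c"] by (simp add: field_simps power2_eq_square)
qed

lemma subspace_closure:
  fixes S :: "'a::real_normed_vector set"
  assumes "subspace S"
  shows "subspace (closure S)"
  unfolding subspace_def
proof (intro conjI ballI allI)
  show "0 \<in> closure S"
    using subspace_0[OF assms] closure_subset by blast
next
  fix x y assume "x \<in> closure S" "y \<in> closure S"
  then obtain f g where "\<And>n. f n \<in> S" "f \<longlonglongrightarrow> x" "\<And>n. g n \<in> S" "g \<longlonglongrightarrow> y"
    unfolding closure_sequential by blast
  then have "\<And>n. f n + g n \<in> S" "(\<lambda>n. f n + g n) \<longlonglongrightarrow> x + y"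
    by (simp_all add: subspace_add[OF assms] tendsto_add)
  then show "x + y \<in> closure S"
    unfolding closure_sequential by (intro exI[of _ "\<lambda>n. f n + g n"]) blast
next
  fix c x assume "x \<in> closure S"
  then obtain f where "\<And>n. f n \<in> S" "f \<longlonglongrightarrow> x"
    unfolding closure_sequential by blast
  then have "\<And>n. c *\<^sub>R f n \<in> S" "(\<lambda>n. c *\<^sub>R f n) \<longlonglongrightarrow> c *\<^sub>R x"
    by (simp_all add: subspace_scale[OF assms] tendsto_scaleR)
  then show "c *\<^sub>R x \<in> closure S"
    unfolding closure_sequential by (intro exI[of _ "\<lambda>n. c *\<^sub>R f n"]) blast
qed

text \<open>A minimising sequence for the distance from \<open>x\<close> to \<open>S\<close> is
  Cauchy by the parallelogram law. Its limit is a nearest point, and minimality under perturbation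
  along \<open>s\<close> gives orthogonality.\<close>

lemma closed_subspace_orthogonal_decomposition:
  fixes S :: "'a::{real_inner,banach} set"
  assumes "subspace S" and "closed S"
  obtains p where "p \<in> S" "\<And>s. s \<in> S \<Longrightarrow> inner (x - p) s = 0"
proof -
  define d where "d = infdist x S"
  have S0: "S \<noteq> {}" using subspace_0[OF assms(1)] by auto
  have d0: "0 \<le> d" unfolding d_def by (rule infdist_nonneg)
  have dle: "d \<le> norm (x - s)" if "s \<in> S" for s
    using infdist_le[OF that, of x] by (simp add: d_def dist_norm)
  have "\<exists>s\<in>S. norm (x - s) < d + inverse (Suc n)" for n :: nat
  proof -
    have "infdist x S < d + inverse (Suc n)" by (simp add: d_def)
    then have "(INF s\<in>S. dist x s) < d + inverse (Suc n)"
      by (simp add: infdist_notempty[OF S0])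
    then show ?thesis
      by (subst (asm) cINF_less_iff[OF S0 bdd_below_image_dist]) (simp add: dist_norm)
  qed
  then obtain f where fS: "\<And>n. f n \<in> S" and fd: "\<And>n. norm (x - f n) < d + inverse (Suc n)"
    by metis
  have lim: "(\<lambda>n. norm (x - f n)) \<longlonglongrightarrow> d"
  proof (rule tendsto_sandwich[of "\<lambda>_. d" _ _ "\<lambda>n. d + inverse (Suc n)"])
    show "(\<lambda>n. d + inverse (real (Suc n))) \<longlonglongrightarrow> d"
      using tendsto_add[OF tendsto_const LIMSEQ_inverse_real_of_nat, of d] by simp
  qed (use dle fS fd in \<open>auto intro!: always_eventually less_imp_le\<close>)
  \<comment> \<open>The midpoint of \<open>f m\<close> and \<open>f n\<close> lies in
    \<open>S\<close>, so its distance from \<open>x\<close> is at least \<open>d\<close>.\<close>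
  have par: "(norm (f m - f n))\<^sup>2 \<le> 2 * (norm (x - f m))\<^sup>2 + 2 * (norm (x - f n))\<^sup>2 - 4 * d\<^sup>2"
    for m n
  proof -
    have "(1/2) *\<^sub>R (f m + f n) \<in> S"
      using assms(1) fS by (simp add: subspace_add subspace_scale)
    then have "d \<le> norm (x - (1/2) *\<^sub>R (f m + f n))" by (rule dle)
    also have "x - (1/2) *\<^sub>R (f m + f n) = (1/2) *\<^sub>R ((x - f m) + (x - f n))"
      by (simp add: algebra_simps flip: scaleR_2)
    finally have "2 * d \<le> norm ((x - f m) + (x - f n))" by simp
    then have "(2 * d)\<^sup>2 \<le> (norm ((x - f m) + (x - f n)))\<^sup>2"
      using d0 by (intro power_mono) auto
    moreover have "(norm ((x - f m) - (x - f n)))\<^sup>2 = (norm (f m - f n))\<^sup>2"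
      by (simp add: norm_minus_commute)
    ultimately show ?thesis
      using parallelogram_law[of "x - f m" "x - f n"] by (simp add: power_mult_distrib)
  qed
  have "Cauchy f"
  proof (rule CauchyI)
    fix e :: real assume e: "e > 0"
    have "(\<lambda>n. (norm (x - f n))\<^sup>2) \<longlonglongrightarrow> d\<^sup>2"
      using lim by (intro tendsto_intros)
    then have "\<forall>\<^sub>F n in sequentially. (norm (x - f n))\<^sup>2 < d\<^sup>2 + e\<^sup>2 / 4"
      by (rule order_tendstoD) (use e in simp)
    then obtain N where N: "\<And>n. n \<ge> N \<Longrightarrow> (norm (x - f n))\<^sup>2 < d\<^sup>2 + e\<^sup>2 / 4"
      by (auto simp: eventually_sequentially)
    show "\<exists>M. \<forall>m\<ge>M. \<forall>n\<ge>M. norm (f m - f n) < e"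
    proof (intro exI allI impI)
      fix m n assume "N \<le> m" "N \<le> n"
      then have "(norm (f m - f n))\<^sup>2 < e\<^sup>2"
        using par[of m n] N[of m] N[of n] by simp
      then show "norm (f m - f n) < e"
        using e by (simp add: power2_less_imp_less)
    qed
  qed
  then obtain p where p: "f \<longlonglongrightarrow> p"
    using Cauchy_convergent_iff convergent_def by blast
  have pS: "p \<in> S" using closed_sequentially[OF assms(2)] fS p by blast
  have "norm (x - p) = d"
    by (rule LIMSEQ_unique[OF _ lim]) (use p in \<open>intro tendsto_intros\<close>)
  then have min: "norm (x - p) \<le> norm (x - s)" if "s \<in> S" for s
    using dle that by simp
  have "inner (x - p) s = 0" if s: "s \<in> S" for s
  proof -
    \<comment> \<open>The explicit constant term 0 makes the discriminant bound read
      \<open>(inner (x - p) s)\<^sup>2 \<le> 0\<close>.\<close>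
    have "0 \<le> 0 + 2 * t * inner (x - p) s + t\<^sup>2 * (inner s s)" for t
    proof -
      have "p - t *\<^sub>R s \<in> S"
        using assms(1) pS s by (simp add: subspace_diff subspace_scale)
      then have "(norm (x - p))\<^sup>2 \<le> (norm (x - p + t *\<^sub>R s))\<^sup>2"
        using min[of "p - t *\<^sub>R s"] by (intro power_mono) (simp_all add: algebra_simps)
      then show ?thesis
        unfolding power2_norm_eq_inner
        by (simp add: inner_add_left inner_add_right inner_commute power2_eq_square algebra_simps)
    qed
    from nonneg_quadratic_discriminant[OF this] show ?thesis by simp
  qed
  with pS show thesis by (rule that)
qed

text \<open>The kernel has codimension one: subtracting a multiple of a vector \<open>w\<close>
  orthogonal to it moves any \<open>x\<close> into the kernel, so \<open>w\<close>, rescaled,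
  represents \<open>f\<close>.\<close>

lemma riesz_representation:
  fixes f :: "'a::{real_inner,banach} \<Rightarrow> real"
  assumes f: "bounded_linear f"
  obtains a where "\<And>x. f x = inner x a"
proof (cases "\<forall>x. f x = 0")
  case True
  then show ?thesis using that[of 0] by simp
next
  case False
  then obtain z where z: "f z \<noteq> 0" by blast
  interpret f: bounded_linear f by (rule f)
  let ?K = "f -` {0}"
  have "subspace ?K"
    by (auto simp: subspace_def f.zero f.add f.scaleR)
  moreover have "closed ?K"
    by (intro continuous_closed_vimage) (simp_all add: f.isCont)
  ultimately obtain p where p: "f p = 0" and orth: "\<And>s. f s = 0 \<Longrightarrow> inner (z - p) s = 0"
    using closed_subspace_orthogonal_decomposition[of ?K z] by auto
  define w where "w = z - p"
  have fw: "f w \<noteq> 0" using z p by (simp add: w_def f.diff)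
  then have ww: "inner w w \<noteq> 0" using f.zero by auto
  show ?thesis
  proof (rule that)
    fix x
    have "f (x - (f x / f w) *\<^sub>R w) = 0"
      using fw by (simp add: f.diff f.scaleR)
    then have "inner w (x - (f x / f w) *\<^sub>R w) = 0"
      using orth by (simp add: w_def)
    then show "f x = inner x ((f w / inner w w) *\<^sub>R w)"
      using fw ww by (simp add: inner_diff_right inner_commute[of w x] field_simps)
  qed
qed

lemma real_adjoint_exists:
  fixes A :: "'a::{real_inner,banach} \<Rightarrow> 'b::real_inner"
  assumes "bounded_linear A"
  obtains S where "bounded_linear S" "\<And>x y. inner (A x) y = inner x (S y)"
proof -
  interpret A: bounded_linear A by (rule assms)
  have "\<exists>a. \<forall>x. inner (A x) y = inner x a" for y
  proof -
    have "bounded_linear (\<lambda>x. inner (A x) y)"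
      by (intro bounded_linear_inner_left_comp assms)
    then show ?thesis by (rule riesz_representation) blast
  qed
  then obtain S where S: "\<And>x y. inner (A x) y = inner x (S y)" by metis
  obtain K where K: "K \<ge> 0" "\<And>x. norm (A x) \<le> norm x * K"
    using A.nonneg_bounded by blast
  have "bounded_linear S"
  proof (rule bounded_linear_intro[where K = K])
    fix x y r
    show "S (x + y) = S x + S y"
      by (subst vector_eq_ldot[symmetric]) (simp add: S[symmetric] inner_add_right)
    show "S (r *\<^sub>R x) = r *\<^sub>R S x"
      by (subst vector_eq_ldot[symmetric]) (simp add: S[symmetric])
    \<comment> \<open>Cancelling one factor \<open>norm (S x)\<close> shows that \<open>S\<close>
      inherits the bound \<open>K\<close> of \<open>A\<close>.\<close>
    have "norm (S x) * norm (S x) = inner (A (S x)) x"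
      by (simp add: S power2_norm_eq_inner flip: power2_eq_square)
    also have "\<dots> \<le> norm (A (S x)) * norm x"
      by (rule norm_cauchy_schwarz)
    also have "\<dots> \<le> norm (S x) * K * norm x"
      using K by (intro mult_right_mono) auto
    finally show "norm (S x) \<le> norm x * K"
      using K(1) by (cases "norm (S x) = 0") (auto simp: mult_ac)
  qed
  then show thesis using S that by blast
qed

section \<open>Positive square roots\<close>

text \<open>Symmetry is demanded separately because over the reals it does not follow from
  nonnegativity of the quadratic form.\<close>

definition pos_semidef :: "('a::real_inner \<Rightarrow> 'a) \<Rightarrow> bool"
  where "pos_semidef P \<longleftrightarrow> bounded_linear P \<and> (\<forall>u v. inner (P u) v = inner u (P v))
    \<and> (\<forall>u. 0 \<le> inner (P u) u)"

lemma pos_semidefD: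
  assumes "pos_semidef P"
  shows "bounded_linear P" "inner (P u) v = inner u (P v)" "0 \<le> inner (P u) u"
  using assms by (auto simp: pos_semidef_def)

lemma pos_semidef_cauchy_schwarz:
  assumes "pos_semidef P"
  shows "(inner (P u) v)\<^sup>2 \<le> inner (P u) u * inner (P v) v"
proof (rule nonneg_quadratic_discriminant)
  note P = pos_semidefD[OF assms]
  interpret P: bounded_linear P by (rule P)
  fix t
  have "0 \<le> inner (P (u + t *\<^sub>R v)) (u + t *\<^sub>R v)" by (rule P)
  also have "inner (P v) u = inner (P u) v"
    by (metis P(2) inner_commute)
  then have "inner (P (u + t *\<^sub>R v)) (u + t *\<^sub>R v)
      = inner (P u) u + 2 * t * inner (P u) v + t\<^sup>2 * inner (P v) v"
    by (simp add: P.add P.scaleR inner_add_left inner_add_right power2_eq_square algebra_simps)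
  finally show "0 \<le> inner (P u) u + 2 * t * inner (P u) v + t\<^sup>2 * inner (P v) v" .
qed (rule pos_semidefD[OF assms])

lemma pos_semidef_kernel:
  assumes "pos_semidef P" and "inner (P u) u = 0"
  shows "P u = 0"
  using pos_semidef_cauchy_schwarz[OF assms(1), of u "P u"] assms(2) by simp

text \<open>Commutation factors \<open>S\<^sup>2 - R\<^sup>2\<close> as
  \<open>(S + R)(S - R)\<close>. So \<open>S + R\<close> kills \<open>w = S u - R u\<close>; by
  positivity \<open>S\<close> and \<open>R\<close> each kill \<open>w\<close>, and symmetry makes
  \<open>w\<close> orthogonal to \<open>S u\<close> and \<open>R u\<close>, hence to itself.\<close>

lemma commuting_pos_semidef_sqrt_unique:
  assumes S: "pos_semidef S" and R: "pos_semidef R"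
    and sq: "\<And>u. S (S u) = R (R u)" and comm: "\<And>u. S (R u) = R (S u)"
  shows "S = R"
proof
  fix u
  interpret S: bounded_linear S by (rule pos_semidefD[OF S])
  interpret R: bounded_linear R by (rule pos_semidefD[OF R])
  define w where "w = S u - R u"
  have "S w + R w = 0" by (simp add: w_def S.diff R.diff sq comm)
  then have "inner (S w) w + inner (R w) w = 0"
    by (simp flip: inner_add_left)
  then have "inner (S w) w = 0" "inner (R w) w = 0"
    using pos_semidefD(3)[OF S, of w] pos_semidefD(3)[OF R, of w] by linarith+
  then have "S w = 0" "R w = 0"
    using pos_semidef_kernel S R by blast+
  then have "inner (S u) w = 0" "inner (R u) w = 0"
    by (simp_all add: pos_semidefD(2)[OF S, of u w] pos_semidefD(2)[OF R, of u w])
  then have "inner w w = 0"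
    using inner_diff_left[of "S u" "R u" w] by (simp flip: w_def)
  then show "S u = R u" by (simp add: w_def)
qed

text \<open>The limit \<open>Y\<close> of this iteration solves \<open>Y = (C + Y\<^sup>2) / 2\<close>, that is
  \<open>(1 - Y)\<^sup>2 = 1 - C\<close>.\<close>

primrec sqrt_iter :: "('a::real_normed_vector \<Rightarrow>\<^sub>L 'a) \<Rightarrow> nat \<Rightarrow> ('a \<Rightarrow>\<^sub>L 'a)" where
  "sqrt_iter C 0 = 0"
| "sqrt_iter C (Suc n) = (1/2) *\<^sub>R (C + (sqrt_iter C n o\<^sub>L sqrt_iter C n))"

text \<open>The scalar case \<open>C = 1\<close> of \<open>sqrt_iter\<close>, which dominates all
  cases with \<open>norm C \<le> 1\<close>.\<close>

primrec sqrt_majorant :: "nat \<Rightarrow> real" where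
  "sqrt_majorant 0 = 0"
| "sqrt_majorant (Suc n) = (1 + (sqrt_majorant n)\<^sup>2) / 2"

lemma sqrt_majorant_bounds: "0 \<le> sqrt_majorant n \<and> sqrt_majorant n \<le> 1"
  by (induction n) (auto simp: power_le_one)

lemma norm_sqrt_iter_le:
  assumes "norm C \<le> 1"
  shows "norm (sqrt_iter C n) \<le> sqrt_majorant n"
proof (induction n)
  case (Suc n)
  have "norm (sqrt_iter C n o\<^sub>L sqrt_iter C n) \<le> norm (sqrt_iter C n) * norm (sqrt_iter C n)"
    by (rule norm_blinfun_compose)
  also have "\<dots> \<le> (sqrt_majorant n)\<^sup>2"
    unfolding power2_eq_square using Suc by (intro mult_mono) (auto intro: order_trans[OF norm_ge_zero])
  finally show ?case
    using assms norm_triangle_ineq[of C "sqrt_iter C n o\<^sub>L sqrt_iter C n"] by simp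
qed simp

lemma norm_sqrt_iter_diff_le:
  assumes "norm C \<le> 1"
  shows "norm (sqrt_iter C (Suc n) - sqrt_iter C n) \<le> sqrt_majorant (Suc n) - sqrt_majorant n"
proof (induction n)
  case 0
  then show ?case using assms by simp
next
  case (Suc n)
  let ?Y = "sqrt_iter C" and ?y = sqrt_majorant
  let ?D = "?Y (Suc n) - ?Y n"
  \<comment> \<open>The difference of squares is split by inserting the mixed product
    \<open>?Y (Suc n) o\<^sub>L ?Y n\<close>; no commutation is used. The majorant satisfies the
    same identity.\<close>
  have "?Y (Suc (Suc n)) - ?Y (Suc n) = (1/2) *\<^sub>R ((?Y (Suc n) o\<^sub>L ?D) + (?D o\<^sub>L ?Y n))"
    unfolding sqrt_iter.simps(2)[of C "Suc n"]
    by (subst (2) sqrt_iter.simps(2))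
      (simp del: sqrt_iter.simps add: bounded_bilinear.diff_left[OF bounded_bilinear_blinfun_compose]
        bounded_bilinear.diff_right[OF bounded_bilinear_blinfun_compose] scaleR_diff_right[symmetric])
  also have "norm \<dots> \<le> (norm (?Y (Suc n)) * norm ?D + norm ?D * norm (?Y n)) / 2"
    using norm_triangle_ineq[of "?Y (Suc n) o\<^sub>L ?D" "?D o\<^sub>L ?Y n"]
      norm_blinfun_compose[of "?Y (Suc n)" ?D] norm_blinfun_compose[of ?D "?Y n"]
    by (simp del: sqrt_iter.simps)
  also have "\<dots> \<le> (?y (Suc n) * (?y (Suc n) - ?y n) + (?y (Suc n) - ?y n) * ?y n) / 2"
    using Suc norm_sqrt_iter_le[OF assms, of n] norm_sqrt_iter_le[OF assms, of "Suc n"]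
      sqrt_majorant_bounds[of "Suc n"] order_trans[OF norm_ge_zero Suc]
    by (intro divide_right_mono add_mono mult_mono) (simp_all del: sqrt_iter.simps sqrt_majorant.simps)
  also have "\<dots> = ?y (Suc (Suc n)) - ?y (Suc n)"
    by (subst (5) sqrt_majorant.simps(2), subst sqrt_majorant.simps(2)[of "Suc n"])
       (simp del: sqrt_majorant.simps add: power2_eq_square field_simps)
  finally show ?case .
qed

text \<open>When \<open>norm C = 1\<close> the iteration need not contract geometrically. Instead
  its increments are dominated by those of the bounded increasing majorant, which are summable by
  telescoping.\<close>

lemma sqrt_iter_convergent:
  fixes C :: "'a::banach \<Rightarrow>\<^sub>L 'a"
  assumes "norm C \<le> 1"
  shows "sqrt_iter C \<longlonglongrightarrow> lim (sqrt_iter C)"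
proof -
  let ?Y = "sqrt_iter C" and ?y = sqrt_majorant
  have "incseq ?y"
    by (rule incseq_SucI)
      (use norm_sqrt_iter_diff_le[OF assms] in \<open>metis diff_ge_0_iff_ge norm_ge_zero order_trans\<close>)
  then have "convergent ?y"
    using incseq_convergent[of ?y 1] sqrt_majorant_bounds by (metis convergentI)
  then have "summable (\<lambda>n. ?y (Suc n) - ?y n)"
    by (metis convergent_def telescope_summable)
  then have "summable (\<lambda>n. ?Y (Suc n) - ?Y n)"
    by (rule summable_comparison_test'[where N = 0]) (rule norm_sqrt_iter_diff_le[OF assms])
  then have "convergent (\<lambda>n. \<Sum>k<n. ?Y (Suc k) - ?Y k)"
    by (simp add: summable_iff_convergent)
  then have "convergent ?Y"
    unfolding sum_lessThan_telescope by simp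
  then show ?thesis by (simp add: convergent_LIMSEQ_iff)
qed

lemma lim_sqrt_iter_fixpoint:
  fixes C :: "'a::banach \<Rightarrow>\<^sub>L 'a"
  assumes "norm C \<le> 1"
  defines "Y \<equiv> lim (sqrt_iter C)"
  shows "Y = (1/2) *\<^sub>R (C + (Y o\<^sub>L Y))" and "norm Y \<le> 1"
proof -
  have Y: "sqrt_iter C \<longlonglongrightarrow> Y"
    unfolding Y_def by (rule sqrt_iter_convergent[OF assms(1)])
  have "(\<lambda>n. sqrt_iter C (Suc n)) \<longlonglongrightarrow> (1/2) *\<^sub>R (C + (Y o\<^sub>L Y))"
    unfolding sqrt_iter.simps
    by (intro tendsto_intros bounded_bilinear.tendsto[OF bounded_bilinear_blinfun_compose] Y)
  then show "Y = (1/2) *\<^sub>R (C + (Y o\<^sub>L Y))"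
    using LIMSEQ_unique LIMSEQ_Suc[OF Y] by blast
  show "norm Y \<le> 1"
  proof (rule LIMSEQ_le_const2[OF tendsto_norm[OF Y]])
    show "\<exists>N. \<forall>n\<ge>N. norm (sqrt_iter C n) \<le> 1"
      using norm_sqrt_iter_le[OF assms(1)] sqrt_majorant_bounds order_trans by blast
  qed
qed

text \<open>The iterates are the same polynomials in \<open>C\<close> and in \<open>D\<close>, so
  \<open>V\<close> passes through each of them and through the limit. Two spaces are allowed since
  \<open>V\<close> will also be \<open>A\<close> itself.\<close>

lemma lim_sqrt_iter_intertwine:
  fixes C :: "'a::banach \<Rightarrow>\<^sub>L 'a" and D :: "'b::banach \<Rightarrow>\<^sub>L 'b"
  assumes "norm C \<le> 1" "norm D \<le> 1" and VC: "V o\<^sub>L C = D o\<^sub>L V"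
  shows "V o\<^sub>L lim (sqrt_iter C) = lim (sqrt_iter D) o\<^sub>L V"
proof -
  have "V o\<^sub>L sqrt_iter C n = sqrt_iter D n o\<^sub>L V" for n
  proof (induction n)
    case (Suc n)
    have V: "V (C u) = D (V u)" for u
      using VC by (metis blinfun_apply_blinfun_compose)
    have IH: "V (sqrt_iter C n u) = sqrt_iter D n (V u)" for u
      using Suc by (metis blinfun_apply_blinfun_compose)
    show ?case
      by (rule blinfun_eqI)
        (simp add: blinfun.add_left blinfun.add_right blinfun.scaleR_left blinfun.scaleR_right V IH)
  qed simp
  moreover have "(\<lambda>n. V o\<^sub>L sqrt_iter C n) \<longlonglongrightarrow> (V o\<^sub>L lim (sqrt_iter C))"
    "(\<lambda>n. sqrt_iter D n o\<^sub>L V) \<longlonglongrightarrow> (lim (sqrt_iter D) o\<^sub>L V)"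
    by (intro bounded_bilinear.tendsto[OF bounded_bilinear_blinfun_compose] tendsto_const
        sqrt_iter_convergent assms)+
  ultimately show ?thesis
    using LIMSEQ_unique by simp
qed

lemma lim_sqrt_iter_symmetric:
  fixes C :: "'a::{real_inner,banach} \<Rightarrow>\<^sub>L 'a"
  assumes "norm C \<le> 1" and sym: "\<And>u v. inner (C u) v = inner u (C v)"
  shows "inner (lim (sqrt_iter C) u) v = inner u (lim (sqrt_iter C) v)"
proof -
  have "inner (sqrt_iter C n u) v = inner u (sqrt_iter C n v)" for n u v
    by (induction n arbitrary: u v)
      (simp_all add: blinfun.add_left blinfun.scaleR_left inner_add_left inner_add_right sym)
  moreover have "(\<lambda>n. inner (sqrt_iter C n u) v) \<longlonglongrightarrow> inner (lim (sqrt_iter C) u) v"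
    "(\<lambda>n. inner u (sqrt_iter C n v)) \<longlonglongrightarrow> inner u (lim (sqrt_iter C) v)"
    by (intro tendsto_intros sqrt_iter_convergent assms)+
  ultimately show ?thesis
    using LIMSEQ_unique by simp
qed

text \<open>The scale \<open>s\<close> is an argument, not a norm computed from \<open>T\<close>, so
  that two intertwined operators can share it.\<close>

definition scaled_sqrt :: "real \<Rightarrow> ('a::banach \<Rightarrow> 'a) \<Rightarrow> 'a \<Rightarrow> 'a"
  where "scaled_sqrt s T u =
    sqrt s *\<^sub>R (u - lim (sqrt_iter (id_blinfun - inverse s *\<^sub>R Blinfun T)) u)"

text \<open>For \<open>T = A\<^sup>* A\<close> this holds as soon as \<open>s\<close> is positive and dominates the squared norm of \<open>A\<close>.\<close>

definition sqrt_scale :: "real \<Rightarrow> ('a::real_inner \<Rightarrow> 'a) \<Rightarrow> bool"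
  where "sqrt_scale s T \<longleftrightarrow> 0 < s \<and> bounded_linear T \<and> (\<forall>u v. inner (T u) v = inner u (T v))
    \<and> (\<forall>u. inner (T u) (T u) \<le> s * inner (T u) u)"

text \<open>Expanding the square and using the domination of \<open>inner (T u) (T u)\<close> leaves
  at most \<open>inner u u - inverse s * inner (T u) u\<close>; the same domination shows that the
  subtracted term is nonnegative.\<close>

lemma sqrt_scale_norm_le:
  assumes "sqrt_scale s T"
  shows "norm (id_blinfun - inverse s *\<^sub>R Blinfun T) \<le> 1"
proof (rule norm_blinfun_bound)
  fix u
  have s: "s > 0" and T: "bounded_linear T" and le: "inner (T u) (T u) \<le> s * inner (T u) u"
    using assms by (auto simp: sqrt_scale_def)
  have "(norm (u - inverse s *\<^sub>R T u))\<^sup>2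
      = inner u u - 2 * inverse s * inner (T u) u + (inverse s)\<^sup>2 * inner (T u) (T u)"
    unfolding power2_norm_eq_inner
    by (simp add: inner_diff_left inner_diff_right inner_commute power2_eq_square)
  also have "(inverse s)\<^sup>2 * inner (T u) (T u) \<le> (inverse s)\<^sup>2 * (s * inner (T u) u)"
    by (intro mult_left_mono le) simp
  also have "\<dots> = inverse s * inner (T u) u"
    using s by (simp add: power2_eq_square)
  also have "inner u u - 2 * inverse s * inner (T u) u + inverse s * inner (T u) u \<le> inner u u"
  proof -
    have "0 \<le> s * inner (T u) u" using le inner_ge_zero[of "T u"] by linarith
    then show ?thesis using s by (simp add: zero_le_mult_iff)
  qed
  finally have "(norm (u - inverse s *\<^sub>R T u))\<^sup>2 \<le> (norm u)\<^sup>2"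
    by (simp add: power2_norm_eq_inner)
  then have "norm (u - inverse s *\<^sub>R T u) \<le> norm u"
    by (rule power2_le_imp_le) simp
  then show "norm ((id_blinfun - inverse s *\<^sub>R Blinfun T) u) \<le> 1 * norm u"
    by (simp add: blinfun.diff_left blinfun.scaleR_left bounded_linear_Blinfun_apply[OF T])
qed simp

lemma scaled_sqrt_square:
  fixes T :: "'a::{real_inner,banach} \<Rightarrow> 'a"
  assumes "sqrt_scale s T"
  shows "scaled_sqrt s T (scaled_sqrt s T u) = T u"
proof -
  define C where "C = id_blinfun - inverse s *\<^sub>R Blinfun T"
  define Y where "Y = lim (sqrt_iter C)"
  have s: "s > 0" and T: "bounded_linear T"
    using assms by (auto simp: sqrt_scale_def)
  have "2 *\<^sub>R Y = C + (Y o\<^sub>L Y)"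
    using lim_sqrt_iter_fixpoint(1)[OF sqrt_scale_norm_le[OF assms]]
    unfolding C_def[symmetric] Y_def[symmetric]
    by (metis (no_types) scaleR_scaleR scaleR_one nonzero_mult_div_cancel_left times_divide_eq_right
        mult.right_neutral zero_neq_numeral)
  then have "blinfun_apply (2 *\<^sub>R Y) u = blinfun_apply (C + (Y o\<^sub>L Y)) u" by simp
  then have "2 *\<^sub>R Y u = u - inverse s *\<^sub>R T u + Y (Y u)"
    by (simp add: C_def blinfun.add_left blinfun.diff_left blinfun.scaleR_left
        bounded_linear_Blinfun_apply[OF T])
  \<comment> \<open>This is \<open>(1 - Y)\<^sup>2 = T / s\<close>, a rearrangement of the fixed
    point equation.\<close>
  then have "inverse s *\<^sub>R T u = u - Y u - Y (u - Y u)"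
    by (simp add: blinfun.diff_right scaleR_2 algebra_simps)
  then have "s *\<^sub>R (u - Y u - Y (u - Y u)) = T u"
    using s by (metis scaleR_scaleR right_inverse scaleR_one less_irrefl)
  then show ?thesis
    using s by (simp add: scaled_sqrt_def blinfun.scaleR_right flip: C_def Y_def scaleR_diff_right)
qed

lemma pos_semidef_scaled_sqrt:
  fixes T :: "'a::{real_inner,banach} \<Rightarrow> 'a"
  assumes "sqrt_scale s T"
  shows "pos_semidef (scaled_sqrt s T)"
proof -
  define C where "C = id_blinfun - inverse s *\<^sub>R Blinfun T"
  define Y where "Y = lim (sqrt_iter C)"
  have s: "s > 0" and T: "bounded_linear T" and sym: "\<And>u v. inner (T u) v = inner u (T v)"
    using assms by (auto simp: sqrt_scale_def)
  have C1: "norm C \<le> 1"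
    unfolding C_def by (rule sqrt_scale_norm_le[OF assms])
  have "inner (C u) v = inner u (C v)" for u v
    by (simp add: C_def blinfun.diff_left blinfun.scaleR_left bounded_linear_Blinfun_apply[OF T]
        inner_diff_left inner_diff_right sym)
  then have Ysym: "inner (Y u) v = inner u (Y v)" for u v
    unfolding Y_def by (rule lim_sqrt_iter_symmetric[OF C1])
  \<comment> \<open>Positivity of \<open>1 - Y\<close>, from \<open>norm Y \<le> 1\<close>.\<close>
  have "inner (Y u) u \<le> inner u u" for u
  proof -
    have "inner (Y u) u \<le> norm (Y u) * norm u" by (rule norm_cauchy_schwarz)
    also have "norm (Y u) \<le> norm Y * norm u" by (rule norm_blinfun)
    also have "norm Y * norm u \<le> 1 * norm u"
      unfolding Y_def by (intro mult_right_mono lim_sqrt_iter_fixpoint C1) simp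
    finally show ?thesis
      by (simp add: mult_right_mono flip: power2_eq_square power2_norm_eq_inner)
  qed
  moreover have eq: "scaled_sqrt s T = (\<lambda>u. sqrt s *\<^sub>R (u - Y u))"
    by (rule ext) (simp add: scaled_sqrt_def C_def Y_def)
  moreover have "bounded_linear (\<lambda>u. sqrt s *\<^sub>R (u - Y u))"
    by (intro bounded_linear_intros)
  ultimately show ?thesis
    using s unfolding pos_semidef_def by (simp add: inner_diff_left inner_diff_right Ysym)
qed

lemma scaled_sqrt_intertwine:
  fixes T :: "'a::{real_inner,banach} \<Rightarrow> 'a" and T' :: "'b::{real_inner,banach} \<Rightarrow> 'b"
  assumes T: "sqrt_scale s T" and T': "sqrt_scale s T'"
    and V: "bounded_linear V" and VT: "\<And>u. V (T u) = T' (V u)"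
  shows "V (scaled_sqrt s T u) = scaled_sqrt s T' (V u)"
proof -
  define C where "C = id_blinfun - inverse s *\<^sub>R Blinfun T"
  define D where "D = id_blinfun - inverse s *\<^sub>R Blinfun T'"
  interpret V: bounded_linear V by (rule V)
  have lin: "bounded_linear T" "bounded_linear T'"
    using T T' by (auto simp: sqrt_scale_def)
  have "Blinfun V o\<^sub>L lim (sqrt_iter C) = lim (sqrt_iter D) o\<^sub>L Blinfun V"
  proof (rule lim_sqrt_iter_intertwine)
    show "Blinfun V o\<^sub>L C = D o\<^sub>L Blinfun V"
      by (rule blinfun_eqI)
        (simp add: C_def D_def blinfun.diff_left blinfun.scaleR_left V VT lin V.diff V.scaleR
          bounded_linear_Blinfun_apply)
  qed (simp_all add: C_def D_def sqrt_scale_norm_le T T')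
  then have "V (lim (sqrt_iter C) w) = lim (sqrt_iter D) (V w)" for w
    by (metis blinfun_apply_blinfun_compose bounded_linear_Blinfun_apply V)
  then show ?thesis
    by (simp add: scaled_sqrt_def V.scaleR V.diff flip: C_def D_def)
qed

section \<open>Inequalities\<close>

text \<open>On the range of \<open>P\<close> the bound is the Cauchy--Schwarz inequality of the form of \<open>Q\<close>, since
  \<open>A (P w) = Q (A w)\<close>; on its orthogonal complement \<open>A\<close> and \<open>P\<close> both vanish.\<close>

lemma mixed_schwarz_real:
  fixes A :: "'a::{real_inner,banach} \<Rightarrow> 'b::real_inner"
  assumes P: "pos_semidef P" and Q: "pos_semidef Q" and A: "bounded_linear A"
    and AP: "\<And>u. A (P u) = Q (A u)" and iso: "\<And>u v. inner (A u) (A v) = inner (P u) (P v)"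
  shows "(inner (A x) y)\<^sup>2 \<le> inner (P x) x * inner (Q y) y"
proof -
  interpret A: bounded_linear A by (rule A)
  interpret P: bounded_linear P by (rule pos_semidefD[OF P])
  let ?G = "{z. (inner (A z) y)\<^sup>2 \<le> inner (P z) z * inner (Q y) y}"
  have "range P \<subseteq> ?G"
  proof clarify
    fix w
    have "(inner (Q (A w)) y)\<^sup>2 \<le> inner (Q (A w)) (A w) * inner (Q y) y"
      by (rule pos_semidef_cauchy_schwarz[OF Q])
    also have "inner (Q (A w)) (A w) = inner (P (P w)) (P w)"
      by (simp add: iso flip: AP)
    finally show "(inner (A (P w)) y)\<^sup>2 \<le> inner (P (P w)) (P w) * inner (Q y) y"
      by (simp add: AP)
  qed
  \<comment> \<open>Both sides are continuous in \<open>z\<close>, so the bound extends to the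
    closure of the range.\<close>
  moreover have "closed ?G"
    by (intro closed_Collect_le continuous_intros A.continuous_on P.continuous_on)
  ultimately have cl: "closure (range P) \<subseteq> ?G"
    by (rule closure_minimal)
  have "subspace (closure (range P))"
    by (intro subspace_closure linear_subspace_image P.linear) simp
  then obtain p where p: "p \<in> closure (range P)"
    and orth: "\<And>s. s \<in> closure (range P) \<Longrightarrow> inner (x - p) s = 0"
    using closed_subspace_orthogonal_decomposition[of "closure (range P)" x] by auto
  define q where "q = x - p"
  \<comment> \<open>By symmetry this is \<open>inner q (P (P q))\<close>, and \<open>q\<close> is
    orthogonal to the range of \<open>P\<close>.\<close>
  have "inner (P q) (P q) = 0"
  proof -
    have "P (P q) \<in> closure (range P)" using closure_subset[of "range P"] by blast
    then show ?thesis using orth by (simp add: q_def pos_semidefD(2)[OF P, of "x - p"])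
  qed
  then have "P q = 0" "A q = 0"
    using iso[of q q] by simp_all
  moreover have "x = p + q" by (simp add: q_def)
  ultimately have "A x = A p" "inner (P x) x = inner (P p) p"
    using pos_semidefD(2)[OF P, of p q] by (simp_all add: A.add P.add inner_add_right)
  then show ?thesis using cl p by auto
qed

section \<open>Complex inner products: sesquilinearity, phases, Cauchy-Schwarz and Buzano\<close>

lemma cinner_add_right: "cinner x (y + z) = cinner x y + cinner x z"
  for x :: "'a::complex_inner"
  by (subst (1 2 3) cinner_commute) (simp add: cinner_add_left)

lemma cinner_scaleC_right: "cinner x (c *\<^sub>C y) = cnj c * cinner x y"
  for x :: "'a::complex_inner"
  by (subst (1 2) cinner_commute) (simp add: cinner_scaleC_left)

text \<open>Recovers the complex inner product from the real one, so real identities at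
  \<open>x\<close> and at \<open>\<i> *\<^sub>C x\<close> yield complex ones.\<close>

lemma Im_cinner: "Im (cinner x y) = - inner (\<i> *\<^sub>C x) y"
  for x :: "'a::complex_inner"
  by (simp add: inner_eq_Re_cinner cinner_scaleC_left)

lemma norm_scaleC: "norm (c *\<^sub>C x) = cmod c * norm x"
  for x :: "'a::complex_inner"
proof -
  have "(norm (c *\<^sub>C x))\<^sup>2 = Re (c * cnj c * cinner x x)"
    by (simp add: power2_norm_eq_inner inner_eq_Re_cinner cinner_scaleC_left cinner_scaleC_right
        mult_ac)
  also have "\<dots> = (cmod c * norm x)\<^sup>2"
    by (simp add: power_mult_distrib power2_norm_eq_inner inner_eq_Re_cinner
        flip: complex_norm_square)
  finally show ?thesis by (simp add: power2_eq_iff_nonneg)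
qed

lemma bounded_linear_scaleC: "bounded_linear (\<lambda>x::'a::complex_inner. c *\<^sub>C x)"
  by (rule bounded_linear_intro[where K = "cmod c"])
    (simp_all add: scaleC_add_right scaleR_scaleC scaleC_scaleC mult.commute norm_scaleC)

text \<open>Rotating a vector by this phase turns a modulus into a real part, which reduces complex
  inequalities to real ones.\<close>

lemma obtain_unimodular:
  obtains c where "cmod c = 1" "c * z = complex_of_real (cmod z)"
proof (cases "z = 0")
  case True
  then show ?thesis using that[of 1] by simp
next
  case False
  then show ?thesis
    using that[of "cnj z / cmod z"]
    by (simp add: norm_divide power2_eq_square mult.commute flip: complex_norm_square)
qed

lemma complex_cauchy_schwarz: "cmod (cinner x y) \<le> norm x * norm y"
  for x :: "'a::complex_inner"
proof -
  obtain c where c: "cmod c = 1" "c * cinner x y = complex_of_real (cmod (cinner x y))"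
    by (rule obtain_unimodular)
  then have "cmod (cinner x y) = inner (c *\<^sub>C x) y"
    by (simp add: inner_eq_Re_cinner cinner_scaleC_left)
  also have "\<dots> \<le> norm (c *\<^sub>C x) * norm y" by (rule norm_cauchy_schwarz)
  finally show ?thesis using c by (simp add: norm_scaleC)
qed

lemma cinner_zero: "cinner 0 y = 0" "cinner x 0 = 0"
  for x y :: "'a::complex_inner"
  using complex_cauchy_schwarz[of 0 y] complex_cauchy_schwarz[of x 0] by auto

lemma cinner_self_eq_norm: "cinner x x = complex_of_real ((norm x)\<^sup>2)"
  for x :: "'a::complex_inner"
  using cinner_self_nonneg[of x]
  by (auto simp: complex_nonneg_Reals_iff complex_eq_iff power2_norm_eq_inner inner_eq_Re_cinner)

text \<open>Reflecting \<open>u\<close> at the line through \<open>y\<close> preserves its norm.\<close>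

lemma buzano_inequality:
  fixes u v y :: "'a::complex_inner"
  assumes "norm y = 1"
  shows "2 * cmod (cinner u y) * cmod (cinner y v) \<le> norm u * norm v + cmod (cinner u v)"
proof -
  define w where "w = (2 * cinner u y) *\<^sub>C y + (-1) *\<^sub>C u"
  have yy: "cinner y y = 1" using assms by (simp add: cinner_self_eq_norm)
  \<comment> \<open>As \<open>norm y = 1\<close>, the term with factor 4 from the square of the
    first summand cancels the two cross terms.\<close>
  have "cinner w w = cinner u u"
    using cinner_commute[of y u]
    by (simp add: w_def cinner_add_left cinner_add_right cinner_scaleC_left cinner_scaleC_right yy
        algebra_simps)
  then have nw: "norm w = norm u" by (simp add: norm_eq_sqrt_cinner)
  have "cinner w v + cinner u v = 2 * cinner u y * cinner y v"
    by (simp add: w_def cinner_add_left cinner_scaleC_left)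
  then have "2 * cmod (cinner u y) * cmod (cinner y v) = cmod (cinner w v + cinner u v)"
    by (simp add: norm_mult)
  also have "\<dots> \<le> cmod (cinner w v) + cmod (cinner u v)" by (rule norm_triangle_ineq)
  also have "\<dots> \<le> norm u * norm v + cmod (cinner u v)"
    using complex_cauchy_schwarz[of w v] nw by simp
  finally show ?thesis .
qed

section \<open>Adjoint and absolute value\<close>

lemma bounded_clinearD:
  assumes "bounded_clinear T"
  shows "bounded_linear T" "T (c *\<^sub>C x) = c *\<^sub>C T x"
  using assms by (auto simp: bounded_clinear_def)

lemma cinner_adjoint_eqI:
  fixes A :: "'a::complex_inner \<Rightarrow> 'b::complex_inner"
  assumes "bounded_clinear A" and "\<And>x y. inner (A x) y = inner x (S y)"
  shows "cinner (A x) y = cinner x (S y)"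
  using assms(2)[of x y] assms(2)[of "\<i> *\<^sub>C x" y]
  by (simp add: complex_eq_iff Im_cinner bounded_clinearD[OF assms(1)] flip: inner_eq_Re_cinner)

text \<open>The real adjoint from Riesz already serves the complex inner product because
  \<open>A\<close> commutes with \<open>\<i>\<close>. Testing against all vectors gives its
  uniqueness, which resolves the \<open>THE\<close>, and its complex linearity.\<close>

lemma adjoint_op:
  fixes A :: "'a::complex_hilbert_space \<Rightarrow> 'b::complex_hilbert_space"
  assumes A: "bounded_clinear A"
  shows "bounded_clinear (adjoint_op A)" and "cinner (A x) y = cinner x (adjoint_op A y)"
proof -
  obtain S where S: "bounded_linear S" "\<And>x y. inner (A x) y = inner x (S y)"
    by (rule real_adjoint_exists[OF bounded_clinearD(1)[OF A]]) blast
  have cS: "cinner (A x) y = cinner x (S y)" for x y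
    by (rule cinner_adjoint_eqI[OF A S(2)])
  have "adjoint_op A = S"
    unfolding adjoint_op_def
  proof (rule the_equality)
    fix S' assume S': "\<forall>x y. cinner (A x) y = cinner x (S' y)"
    show "S' = S"
    proof
      fix y
      have "inner x (S' y) = inner x (S y)" for x
        using S' cS by (metis inner_eq_Re_cinner)
      then show "S' y = S y" by (metis vector_eq_ldot)
    qed
  qed (use cS in blast)
  moreover have "S (c *\<^sub>C y) = c *\<^sub>C S y" for c y
  proof -
    have "inner x (S (c *\<^sub>C y)) = inner x (c *\<^sub>C S y)" for x
      by (simp add: inner_eq_Re_cinner cinner_scaleC_right flip: cS)
    then show ?thesis by (metis vector_eq_ldot)
  qed
  ultimately show "bounded_clinear (adjoint_op A)" "cinner (A x) y = cinner x (adjoint_op A y)"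
    using S cS by (auto simp: bounded_clinear_def)
qed

lemma inner_adjoint_op:
  assumes "bounded_clinear A"
  shows "inner (A x) y = inner x (adjoint_op A y)"
  by (simp add: inner_eq_Re_cinner adjoint_op(2)[OF assms])

lemma adjoint_op_adjoint_op:
  assumes "bounded_clinear A"
  shows "adjoint_op (adjoint_op A) = A"
proof
  fix x
  have "inner y (adjoint_op (adjoint_op A) x) = inner y (A x)" for y
    by (metis assms adjoint_op(1) inner_adjoint_op inner_commute)
  then show "adjoint_op (adjoint_op A) x = A x" by (metis vector_eq_ldot)
qed

text \<open>Over the complex numbers, real values of the quadratic form force symmetry, by
  polarisation; conversely, symmetry makes each value its own conjugate.\<close>

lemma positive_op_iff_pos_semidef:
  "positive_op T \<longleftrightarrow> bounded_clinear T \<and> pos_semidef T"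
proof (cases "bounded_clinear T")
  case True
  note T = bounded_clinearD[OF True]
  interpret T: bounded_linear T by (rule T)
  have *: "pos_semidef T" if pos: "\<And>u. cinner (T u) u \<in> \<real>\<^sub>\<ge>\<^sub>0"
  proof -
    have Im0: "Im (cinner (T u) v) = - Im (cinner (T v) u)" for u v
      using pos[of "u + v"] pos[of u] pos[of v]
      by (simp add: complex_nonneg_Reals_iff T.add cinner_add_left cinner_add_right)
    \<comment> \<open>Replacing \<open>u\<close> by \<open>\<i> *\<^sub>C u\<close> turns the
      relation of imaginary parts into one of real parts.\<close>
    have "inner (T u) v = inner u (T v)" for u v
      using Im0[of "\<i> *\<^sub>C u" v] inner_commute[of u "T v"]
      by (simp add: T cinner_scaleC_left cinner_scaleC_right inner_eq_Re_cinner)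
    then show ?thesis
      using pos T by (simp add: pos_semidef_def complex_nonneg_Reals_iff inner_eq_Re_cinner)
  qed
  have "cinner (T u) u \<in> \<real>\<^sub>\<ge>\<^sub>0" if "pos_semidef T" for u
  proof -
    have "cinner (T u) u = cinner u (T u)"
      by (rule cinner_adjoint_eqI[OF True]) (rule pos_semidefD[OF that])
    then have "Im (cinner (T u) u) = 0"
      using cinner_commute[of u "T u"] by (simp add: complex_eq_iff)
    then show ?thesis
      using pos_semidefD(3)[OF that, of u] by (simp add: complex_nonneg_Reals_iff inner_eq_Re_cinner)
  qed
  with * True show ?thesis by (auto simp: positive_op_def)
qed (simp add: positive_op_def)

text \<open>With \<open>T = A^* A\<close>, the bound at \<open>A u\<close> reads
  \<open>inner (T u) (T u) \<le> s * inner (A u) (A u)\<close>, and the last factor is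
  \<open>inner (T u) u\<close>.\<close>

lemma sqrt_scale_adjoint_comp:
  assumes A: "bounded_clinear A" and s: "s > 0"
    and bound: "\<And>y. (norm (adjoint_op A y))\<^sup>2 \<le> s * (norm y)\<^sup>2"
  shows "sqrt_scale s (adjoint_op A \<circ> A)"
proof -
  have "bounded_linear (adjoint_op A \<circ> A)"
    unfolding comp_def
    by (rule bounded_linear_compose[OF bounded_clinearD(1)[OF adjoint_op(1)[OF A]]
          bounded_clinearD(1)[OF A]])
  moreover have "inner (adjoint_op A (A u)) v = inner (A u) (A v)" for u v
    by (metis A inner_adjoint_op inner_commute)
  moreover have "inner u (adjoint_op A (A v)) = inner (A u) (A v)" for u v
    by (simp add: A inner_adjoint_op)
  ultimately show ?thesis
    using s bound[of "A u" for u] by (simp add: sqrt_scale_def power2_norm_eq_inner)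
qed

lemma abs_op_eq_scaled_sqrt:
  fixes A :: "'a::complex_hilbert_space \<Rightarrow> 'b::complex_hilbert_space"
  assumes A: "bounded_clinear A" and s: "sqrt_scale s (adjoint_op A \<circ> A)"
  shows "abs_op A = scaled_sqrt s (adjoint_op A \<circ> A)"
    and "bounded_clinear (scaled_sqrt s (adjoint_op A \<circ> A))"
proof -
  define T where "T = adjoint_op A \<circ> A"
  define R where "R = scaled_sqrt s T"
  have s: "sqrt_scale s T" using s by (simp add: T_def)
  have R: "pos_semidef R" unfolding R_def by (rule pos_semidef_scaled_sqrt[OF s])
  have RR: "R (R u) = T u" for u unfolding R_def by (rule scaled_sqrt_square[OF s])
  \<comment> \<open>Scalar multiplication is a real-linear map commuting with \<open>T\<close>, so
    it commutes with the root.\<close>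
  have "R (c *\<^sub>C u) = c *\<^sub>C R u" for c u
    unfolding R_def
    by (rule scaled_sqrt_intertwine[OF s s bounded_linear_scaleC, symmetric])
      (simp add: T_def bounded_clinearD[OF A] bounded_clinearD[OF adjoint_op(1)[OF A]])
  then have cR: "bounded_clinear R"
    using pos_semidefD(1)[OF R] by (simp add: bounded_clinear_def)
  have "sqrt_op T = R"
    unfolding sqrt_op_def
  proof (rule the_equality)
    fix S assume S: "positive_op S \<and> S \<circ> S = T"
    then have SS: "S (S u) = T u" for u by (metis comp_apply)
    have pS: "pos_semidef S" using S by (simp add: positive_op_iff_pos_semidef)
    show "S = R"
    proof (rule commuting_pos_semidef_sqrt_unique[OF pS R])
      \<comment> \<open>Any root \<open>S\<close> commutes with \<open>T = S \<circ> S\<close>,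
        hence with \<open>R\<close>; this is what the uniqueness lemma asks for.\<close>
      show "S (R u) = R (S u)" for u
        unfolding R_def
        by (rule scaled_sqrt_intertwine[OF s s pos_semidefD(1)[OF pS]]) (simp flip: SS)
    qed (simp add: SS RR)
  qed (simp add: positive_op_iff_pos_semidef cR R fun_eq_iff RR)
  then show "abs_op A = scaled_sqrt s (adjoint_op A \<circ> A)"
    "bounded_clinear (scaled_sqrt s (adjoint_op A \<circ> A))"
    using cR by (simp_all add: abs_op_def T_def R_def)
qed

lemma obtain_sqrt_scale:
  fixes A :: "'a::complex_hilbert_space \<Rightarrow> 'b::complex_hilbert_space"
  assumes A: "bounded_clinear A"
  obtains s where "sqrt_scale s (adjoint_op A \<circ> A)" "sqrt_scale s (A \<circ> adjoint_op A)"
proof -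
  note A' = adjoint_op(1)[OF A]
  obtain K where K: "K > 0" "\<And>x. norm (A x) \<le> norm x * K"
    using bounded_linear.pos_bounded[OF bounded_clinearD(1)[OF A]] by blast
  obtain L where L: "L > 0" "\<And>x. norm (adjoint_op A x) \<le> norm x * L"
    using bounded_linear.pos_bounded[OF bounded_clinearD(1)[OF A']] by blast
  \<comment> \<open>One bound for \<open>A\<close> and its adjoint, so that \<open>M\<^sup>2\<close>
    is a scale common to both products.\<close>
  define M where "M = max K L"
  have M: "M > 0" "K \<le> M" "L \<le> M"
    using K(1) by (auto simp: M_def)
  have sqA: "(norm (A x))\<^sup>2 \<le> M\<^sup>2 * (norm x)\<^sup>2" for x
  proof -
    have "norm (A x) \<le> norm x * M"
      by (rule order_trans[OF K(2) mult_left_mono[OF M(2) norm_ge_zero]])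
    from power_mono[OF this norm_ge_zero, of 2] show ?thesis
      by (simp only: power_mult_distrib mult.commute)
  qed
  have sqA': "(norm (adjoint_op A y))\<^sup>2 \<le> M\<^sup>2 * (norm y)\<^sup>2" for y
  proof -
    have "norm (adjoint_op A y) \<le> norm y * M"
      by (rule order_trans[OF L(2) mult_left_mono[OF M(3) norm_ge_zero]])
    from power_mono[OF this norm_ge_zero, of 2] show ?thesis
      by (simp only: power_mult_distrib mult.commute)
  qed
  have M2: "M\<^sup>2 > 0" using M(1) by (rule zero_less_power)
  show thesis
  proof (rule that)
    show "sqrt_scale (M\<^sup>2) (adjoint_op A \<circ> A)"
      by (rule sqrt_scale_adjoint_comp[OF A M2 sqA'])
    show "sqrt_scale (M\<^sup>2) (A \<circ> adjoint_op A)"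
      using sqrt_scale_adjoint_comp[OF A' M2] sqA
      unfolding adjoint_op_adjoint_op[OF A] by blast
  qed
qed

lemma abs_op:
  fixes A :: "'a::complex_hilbert_space \<Rightarrow> 'b::complex_hilbert_space"
  assumes A: "bounded_clinear A"
  shows "bounded_clinear (abs_op A)" "pos_semidef (abs_op A)"
    "abs_op A (abs_op A u) = adjoint_op A (A u)"
    "A (abs_op A u) = abs_op (adjoint_op A) (A u)"
proof -
  obtain s where s: "sqrt_scale s (adjoint_op A \<circ> A)" "sqrt_scale s (A \<circ> adjoint_op A)"
    using obtain_sqrt_scale[OF A] by blast
  note eq = abs_op_eq_scaled_sqrt[OF A s(1)]
  have eq': "abs_op (adjoint_op A) = scaled_sqrt s (A \<circ> adjoint_op A)"
    using abs_op_eq_scaled_sqrt(1)[OF adjoint_op(1)[OF A], of s] s(2)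
    unfolding adjoint_op_adjoint_op[OF A] by blast
  show "bounded_clinear (abs_op A)" "pos_semidef (abs_op A)"
    "abs_op A (abs_op A u) = adjoint_op A (A u)"
    unfolding eq(1) using eq(2) pos_semidef_scaled_sqrt[OF s(1)] scaled_sqrt_square[OF s(1), of u]
    by (simp_all only: comp_apply)
  \<comment> \<open>\<open>A\<close> intertwines \<open>A^* A\<close> with \<open>A A^*\<close>, and
    both roots are taken at the same scale.\<close>
  show "A (abs_op A u) = abs_op (adjoint_op A) (A u)"
    unfolding eq(1) eq'
    by (rule scaled_sqrt_intertwine[OF s bounded_clinearD(1)[OF A]]) simp
qed

lemma abs_op_cinner_real:
  assumes "bounded_clinear A"
  shows "cinner (abs_op A u) u = complex_of_real (inner (abs_op A u) u)"
  using abs_op(1,2)[OF assms] positive_op_iff_pos_semidef[of "abs_op A"]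
  by (auto simp: positive_op_def complex_nonneg_Reals_iff complex_eq_iff inner_eq_Re_cinner)

lemma inner_abs_op_abs_op:
  assumes "bounded_clinear A"
  shows "inner (abs_op A u) (abs_op A v) = inner (A u) (A v)"
  using abs_op(3)[OF assms, of v] inner_adjoint_op[OF assms, of u "A v"]
    pos_semidefD(2)[OF abs_op(2)[OF assms], of u "abs_op A v"] by simp

text \<open>The real version is applied to \<open>x\<close> rotated by a phase that makes
  \<open>cinner (A x) y\<close> real and nonnegative; the form of \<open>abs_op A\<close> does not
  change because \<open>c * cnj c = 1\<close>.\<close>

lemma mixed_schwarz:
  fixes A :: "'a::complex_hilbert_space \<Rightarrow> 'b::complex_hilbert_space"
  assumes A: "bounded_clinear A"
  shows "(cmod (cinner (A x) y))\<^sup>2 \<le> inner (abs_op A x) x * inner (abs_op (adjoint_op A) y) y"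
proof -
  obtain c where c: "cmod c = 1" "c * cinner (A x) y = complex_of_real (cmod (cinner (A x) y))"
    by (rule obtain_unimodular)
  have cc: "c * cnj c = 1" using c(1) by (simp add: complex_norm_square[symmetric])
  have "(inner (A (c *\<^sub>C x)) y)\<^sup>2
      \<le> inner (abs_op A (c *\<^sub>C x)) (c *\<^sub>C x) * inner (abs_op (adjoint_op A) y) y"
    by (rule mixed_schwarz_real)
      (simp_all add: A abs_op adjoint_op bounded_clinearD inner_abs_op_abs_op)
  also have "inner (A (c *\<^sub>C x)) y = cmod (cinner (A x) y)"
    using c(2) by (simp add: inner_eq_Re_cinner bounded_clinearD[OF A] cinner_scaleC_left)
  also have "cinner (abs_op A (c *\<^sub>C x)) (c *\<^sub>C x) = (c * cnj c) * cinner (abs_op A x) x"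
    by (simp add: bounded_clinearD[OF abs_op(1)[OF A]] cinner_scaleC_left cinner_scaleC_right)
  then have "inner (abs_op A (c *\<^sub>C x)) (c *\<^sub>C x) = inner (abs_op A x) x"
    by (simp add: inner_eq_Re_cinner cc)
  finally show ?thesis .
qed

section \<open>The main inequality\<close>

lemma numerical_radius_upper:
  assumes T: "bounded_linear T" and "norm x = 1"
  shows "cmod (cinner (T x) x) \<le> numerical_radius T"
  unfolding numerical_radius_def
proof (rule cSUP_upper)
  \<comment> \<open>Boundedness by the operator norm makes the supremum a genuine upper
    bound.\<close>
  show "bdd_above ((\<lambda>x. cmod (cinner (T x) x)) ` {x. norm x = 1})"
  proof (rule bdd_aboveI2)
    fix u :: 'a assume "u \<in> {x. norm x = 1}"
    then show "cmod (cinner (T u) u) \<le> onorm T"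
      using complex_cauchy_schwarz[of "T u" u] onorm[OF T, of u] by simp
  qed
qed (use assms in simp)

text \<open>Both quadratic forms are real, so they are the real and imaginary parts of one value of
  the form of the combined operator.\<close>

lemma numerical_radius_abs_op_upper:
  assumes A: "bounded_clinear A" and B: "bounded_clinear B" and x: "norm x = 1"
  shows "sqrt ((inner (abs_op A x) x)\<^sup>2 + (inner (abs_op B x) x)\<^sup>2)
    \<le> numerical_radius (\<lambda>u. abs_op A u + \<i> *\<^sub>C abs_op B u)"
proof -
  have "bounded_linear (\<lambda>u. abs_op A u + \<i> *\<^sub>C abs_op B u)"
    by (intro bounded_linear_add bounded_linear_compose[OF bounded_linear_scaleC]
        bounded_clinearD abs_op A B)
  note numerical_radius_upper[OF this x]
  moreover have "cmod (cinner (abs_op A x + \<i> *\<^sub>C abs_op B x) x)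
      = sqrt ((inner (abs_op A x) x)\<^sup>2 + (inner (abs_op B x) x)\<^sup>2)"
    by (simp add: cinner_add_left cinner_scaleC_left abs_op_cinner_real A B cmod_def)
  ultimately show ?thesis by simp
qed

lemma norm_square_sum_le_onorm:
  fixes A :: "'a::complex_hilbert_space \<Rightarrow> 'b::complex_hilbert_space"
    and B :: "'a \<Rightarrow> 'c::complex_hilbert_space"
  assumes A: "bounded_clinear A" and B: "bounded_clinear B" and x: "norm x = 1"
  shows "(norm (A x))\<^sup>2 + (norm (B x))\<^sup>2
    \<le> onorm (\<lambda>u. (abs_op A ^^ 2) u + (abs_op B ^^ 2) u)"
proof -
  let ?T = "\<lambda>u. (abs_op A ^^ 2) u + (abs_op B ^^ 2) u"
  note lin = bounded_clinearD(1)[OF abs_op(1)[OF A]] bounded_clinearD(1)[OF abs_op(1)[OF B]]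
  have T: "bounded_linear ?T"
    using bounded_linear_add[OF bounded_linear_compose[OF lin(1) lin(1)]
        bounded_linear_compose[OF lin(2) lin(2)]]
    by (simp add: numeral_2_eq_2)
  \<comment> \<open>Here \<open>^^ 2\<close> is composition with itself, so each summand is
    \<open>|A|\<^sup>2\<close> tested on \<open>x\<close>.\<close>
  have "(norm (A x))\<^sup>2 + (norm (B x))\<^sup>2 = inner (?T x) x"
    unfolding power2_norm_eq_inner
    by (simp add: numeral_2_eq_2 inner_add_left pos_semidefD(2)[OF abs_op(2)] A B
        flip: inner_abs_op_abs_op)
  also have "\<dots> \<le> norm (?T x) * norm x" by (rule norm_cauchy_schwarz)
  also have "\<dots> \<le> onorm ?T" using onorm[OF T, of x] x by simp
  finally show ?thesis .
qed

lemma unit_vector_inequality: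
  fixes A :: "'a::complex_hilbert_space \<Rightarrow> 'b::complex_hilbert_space"
    and B :: "'b \<Rightarrow> 'a"
  assumes A: "bounded_clinear A" and B: "bounded_clinear B" and x: "norm x = 1" and y: "norm y = 1"
  shows "cmod (cinner (A x) y) + cmod (cinner (B y) x)
    \<le> sqrt (numerical_radius (\<lambda>u. abs_op A u + \<i> *\<^sub>C abs_op (adjoint_op B) u)
              * numerical_radius (\<lambda>v. abs_op (adjoint_op A) v + \<i> *\<^sub>C abs_op B v)
            + 1 / 2 * onorm (\<lambda>u. (abs_op A ^^ 2) u + (abs_op (adjoint_op B) ^^ 2) u)
            + numerical_radius (B \<circ> A))"
    (is "?p + ?q \<le> sqrt (?w1 * ?w2 + 1 / 2 * ?n + ?w3)")
proof -
  note A' = adjoint_op(1)[OF A] and B' = adjoint_op(1)[OF B]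
  define a where "a = inner (abs_op A x) x"
  define b where "b = inner (abs_op (adjoint_op B) x) x"
  define c where "c = inner (abs_op (adjoint_op A) y) y"
  define d where "d = inner (abs_op B y) y"
  \<comment> \<open>Brings \<open>y\<close> into both inner products, as Buzano's inequality
    requires.\<close>
  have q: "?q = cmod (cinner y (adjoint_op B x))" by (simp add: adjoint_op(2)[OF B])
  have "?p\<^sup>2 \<le> a * c"
    unfolding a_def c_def by (rule mixed_schwarz[OF A])
  moreover have "?q\<^sup>2 \<le> d * b"
    unfolding b_def d_def by (rule mixed_schwarz[OF B])
  moreover have "a * c + d * b \<le> sqrt (a\<^sup>2 + b\<^sup>2) * sqrt (c\<^sup>2 + d\<^sup>2)"
  proof -
    \<comment> \<open>Lagrange's identity; dropping the second square gives Cauchy-Schwarz in the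
      plane.\<close>
    have "(a * c + d * b)\<^sup>2 + (a * d - b * c)\<^sup>2 = (a\<^sup>2 + b\<^sup>2) * (c\<^sup>2 + d\<^sup>2)"
      by (simp add: power2_eq_square algebra_simps)
    then have "(a * c + d * b)\<^sup>2 \<le> (a\<^sup>2 + b\<^sup>2) * (c\<^sup>2 + d\<^sup>2)"
      by (metis le_add_same_cancel1 zero_le_power2)
    then show ?thesis
      by (metis real_le_rsqrt real_sqrt_mult)
  qed
  moreover have "sqrt (a\<^sup>2 + b\<^sup>2) * sqrt (c\<^sup>2 + d\<^sup>2) \<le> ?w1 * ?w2"
  proof -
    have 1: "sqrt (a\<^sup>2 + b\<^sup>2) \<le> ?w1"
      unfolding a_def b_def by (rule numerical_radius_abs_op_upper[OF A B' x])
    have 2: "sqrt (c\<^sup>2 + d\<^sup>2) \<le> ?w2"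
      unfolding c_def d_def by (rule numerical_radius_abs_op_upper[OF A' B y])
    show ?thesis
      by (intro mult_mono 1 2 order_trans[OF _ 1]) simp_all
  qed
  moreover have "2 * ?p * ?q \<le> 1 / 2 * ?n + ?w3"
  proof -
    have "2 * ?p * ?q \<le> norm (A x) * norm (adjoint_op B x) + cmod (cinner (A x) (adjoint_op B x))"
      unfolding q by (rule buzano_inequality[OF y])
    also have "norm (A x) * norm (adjoint_op B x)
        \<le> 1 / 2 * ((norm (A x))\<^sup>2 + (norm (adjoint_op B x))\<^sup>2)"
      using sum_squares_bound[of "norm (A x)" "norm (adjoint_op B x)"] by simp
    also have "\<dots> \<le> 1 / 2 * ?n"
      using norm_square_sum_le_onorm[OF A B' x] by simp
    also have "cinner (A x) (adjoint_op B x) = cinner ((B \<circ> A) x) x"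
      by (simp add: adjoint_op(2)[OF B])
    also have "cmod \<dots> \<le> ?w3"
    proof (rule numerical_radius_upper[OF _ x])
      show "bounded_linear (B \<circ> A)"
        unfolding comp_def
        by (rule bounded_linear_compose[OF bounded_clinearD(1)[OF B] bounded_clinearD(1)[OF A]])
    qed
    finally show ?thesis by simp
  qed
  ultimately have "(?p + ?q)\<^sup>2 \<le> ?w1 * ?w2 + 1 / 2 * ?n + ?w3"
    by (simp add: power2_sum)
  then show ?thesis by (rule real_le_rsqrt)
qed

theorem lemma2p2:
  fixes A :: "'a::complex_hilbert_space \<Rightarrow> 'b::complex_hilbert_space"
    and B :: "'b \<Rightarrow> 'a"
    and x :: 'a and y :: 'b
  assumes "bounded_clinear A" and "bounded_clinear B"
  shows "cmod (cinner (A x) y) + cmod (cinner (B y) x)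
    \<le> sqrt (numerical_radius (\<lambda>u. abs_op A u + \<i> *\<^sub>C abs_op (adjoint_op B) u)
              * numerical_radius (\<lambda>v. abs_op (adjoint_op A) v + \<i> *\<^sub>C abs_op B v)
            + 1 / 2 * onorm (\<lambda>u. (abs_op A ^^ 2) u + (abs_op (adjoint_op B) ^^ 2) u)
            + numerical_radius (B \<circ> A))
      * norm x * norm y"
    (is "_ \<le> ?s * norm x * norm y")
\<comment> \<open>Zero vectors cannot be normalised, and on a zero space the numerical radius is
  unspecified; here both sides vanish.\<close>
proof (cases "x = 0 \<or> y = 0")
  case True
  moreover have "A 0 = 0" "B 0 = 0"
    using assms[THEN bounded_clinearD(1)] by (simp_all add: linear_0 bounded_linear.linear)
  ultimately show ?thesis by (auto simp: cinner_zero)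
next
  case False
  define u where "u = sgn x"
  define v where "v = sgn y"
  have uv: "norm u = 1" "norm v = 1"
    using False by (auto simp: u_def v_def norm_sgn)
  have xy: "x = complex_of_real (norm x) *\<^sub>C u" "y = complex_of_real (norm y) *\<^sub>C v"
    using False by (auto simp: u_def v_def sgn_div_norm simp flip: scaleR_scaleC)
  \<comment> \<open>The scalars extracted are real, so conjugation in the second argument has no
    effect.\<close>
  have 1: "cinner (A x) y = complex_of_real (norm x) * complex_of_real (norm y) * cinner (A u) v"
    by (subst xy(1), subst xy(2))
      (simp add: bounded_clinearD[OF assms(1)] cinner_scaleC_left cinner_scaleC_right)
  have 2: "cinner (B y) x = complex_of_real (norm x) * complex_of_real (norm y) * cinner (B v) u"
    by (subst xy(1), subst xy(2))
      (simp add: bounded_clinearD[OF assms(2)] cinner_scaleC_left cinner_scaleC_right)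
  have "cmod (cinner (A x) y) + cmod (cinner (B y) x)
      = (cmod (cinner (A u) v) + cmod (cinner (B v) u)) * (norm x * norm y)"
    unfolding 1 2 by (simp add: norm_mult algebra_simps)
  also have "\<dots> \<le> ?s * (norm x * norm y)"
    by (intro mult_right_mono unit_vector_inequality assms uv) simp
  finally show ?thesis by (simp add: mult.assoc)
qed

end
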